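(* Let $\mathbb{K}$ be a totally ordered field satisfying any one of the following: (i) Bolzano completeness. (ii) Weierstrass completeness. (iii) Monotone completeness. (iv) Dedekind completeness. (v) Cantor $\kappa$-completeness for some uncountable cardinal $\kappa>\mathrm{card}(\mathbb{K})$. (vi) Leibniz completeness, in the sense that every finite element of ${}^*\mathbb{K}$ can be decomposed uniquely into the sum of an element of $\mathbb{K}$ and an infinitesimal of ${}^*\mathbb{K}$. Then $\mathbb{K}$ is Archimedean. Consequently, if $\mathbb{K}$ is non-Archimedean, then each of (i)-(vi) is false.
   Context: A totally ordered field $\mathbb{K}$ carries the order topology, and $|x|=\max(-x,x)$. It is Archimedean if for every $x\in\mathbb{K}$ there is $n\in\mathbb{N}$ with $|x|\le n$. Non-standard extension: fix a free ultrafilter $\mathcal{U}$ on $\mathbb{N}$. Then ${}^*\mathbb{K}=\mathbb{K}^{\mathbb{N}}/\sim$, where $(a_n)\sim(b_n)$ iff $\{n: a_n=b_n\}\in\mathcal{U}$, is an ordered field (with $\langle a_n\rangle<\langle b_n\rangle$ iff $\{n: a_n<b_n\}\in\mathcal{U}$) containing $\mathbb{K}$ through constant sequences. An element $x$ of a totally ordered field is finite if $|x|\le n$ for some $n\in\mathbb{N}$, and infinitesimal if $|x|<1/n$ for all $n\in\mathbb{N}$, $n\ge 1$. Definitions: - Bolzano complete: every bounded infinite subset of $\mathbb{K}$ has a cluster point in $\mathbb{K}$. - Weierstrass complete: every bounded sequence in $\mathbb{K}$ has a subsequence convergent in $\mathbb{K}$. - Monotone complete: every bounded increasing sequence in $\mathbb{K}$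 converges in $\mathbb{K}$. - Dedekind complete: every non-empty subset of $\mathbb{K}$ bounded from above has a supremum in $\mathbb{K}$. - Cantor $\kappa$-complete ($\kappa$ an uncountable cardinal): every family of fewer than $\kappa$ closed bounded intervals $[a_\gamma,b_\gamma]$ in $\mathbb{K}$ with the finite intersection property has non-empty intersection. *)

theory Defs
  imports "HOL-Analysis.Elementary_Topology" "HOL-Library.Lub_Glb"
begin

unbundle cardinal_syntax

text \<open>
  A totally ordered field with its order topology is a type of sort
  \<open>{linordered_field, linorder_topology}\<close>; properties of the field are predicates on
  \<open>'a itself\<close>.
\<close>

definition archimedean :: "'a::linordered_field itself \<Rightarrow> bool" where
  "archimedean K \<longleftrightarrow> (\<forall>x::'a. \<exists>n::nat. \<bar>x\<bar> \<le> of_nat n)"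

definition order_bounded :: "'a::linorder set \<Rightarrow> bool" where
  "order_bounded S \<longleftrightarrow> bdd_below S \<and> bdd_above S"

definition bolzano_complete :: "'a::{linordered_field, linorder_topology} itself \<Rightarrow> bool" where
  "bolzano_complete K \<longleftrightarrow>
     (\<forall>S::'a set. order_bounded S \<and> infinite S \<longrightarrow> (\<exists>x. x islimpt S))"

definition weierstrass_complete :: "'a::{linordered_field, linorder_topology} itself \<Rightarrow> bool" where
  "weierstrass_complete K \<longleftrightarrow>
     (\<forall>X::nat \<Rightarrow> 'a. order_bounded (range X) \<longrightarrow>
        (\<exists>r::nat \<Rightarrow> nat. strict_mono r \<and> convergent (X \<circ> r)))"

definition monotone_complete :: "'a::{linordered_field, linorder_topology} itself \<Rightarrow> bool" where
  "monotone_complete K \<longleftrightarrow>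
     (\<forall>X::nat \<Rightarrow> 'a. order_bounded (range X) \<and> incseq X \<longrightarrow> convergent X)"

definition dedekind_complete :: "'a::linordered_field itself \<Rightarrow> bool" where
  "dedekind_complete K \<longleftrightarrow>
     (\<forall>S::'a set. S \<noteq> {} \<and> bdd_above S \<longrightarrow> (\<exists>s. isLub UNIV S s))"

definition uncountable_cardinal :: "'k rel \<Rightarrow> bool" where
  "uncountable_cardinal \<kappa> \<longleftrightarrow> Card_order \<kappa> \<and> natLeq <o \<kappa>"

text \<open>
  A cardinal \<open>\<kappa>\<close> is a cardinal order on some type \<open>'k\<close>. Every set with fewer than
  \<open>\<kappa>\<close> elements is equipollent to a subset of the field of \<open>\<kappa>\<close>, so letting the index set
  range over sets of elements of \<open>'k\<close> covers all families of fewer than \<open>\<kappa>\<close> intervals.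
\<close>

definition cantor_complete :: "'k rel \<Rightarrow> 'a::linordered_field itself \<Rightarrow> bool" where
  "cantor_complete \<kappa> K \<longleftrightarrow>
     (\<forall>(\<Gamma>::'k set) (a::'k \<Rightarrow> 'a) (b::'k \<Rightarrow> 'a).
        |\<Gamma>| <o \<kappa> \<and> (\<forall>\<Delta>. \<Delta> \<subseteq> \<Gamma> \<and> finite \<Delta> \<longrightarrow> (\<Inter>\<gamma>\<in>\<Delta>. {a \<gamma>..b \<gamma>}) \<noteq> {})
        \<longrightarrow> (\<Inter>\<gamma>\<in>\<Gamma>. {a \<gamma>..b \<gamma>}) \<noteq> {})"


subsection \<open>The non-standard extension\<close>

text \<open>
  For a filter \<open>U\<close>, \<^term>\<open>eventually P U\<close> says that the set \<open>{n. P n}\<close> belongs to \<open>U\<close>.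
  An ultrafilter is free if the intersection of its members is empty.
\<close>

definition free_ultrafilter :: "nat filter \<Rightarrow> bool" where
  "free_ultrafilter U \<longleftrightarrow>
     U \<noteq> bot \<and> (\<forall>P. eventually P U \<or> eventually (\<lambda>n. \<not> P n) U) \<and>
     \<Inter>{A. eventually (\<lambda>n. n \<in> A) U} = {}"

definition hyper_rel :: "nat filter \<Rightarrow> (nat \<Rightarrow> 'a) rel" where
  "hyper_rel U = {(x, y). eventually (\<lambda>n. x n = y n) U}"

text \<open>The quotient depends on the variable \<open>U\<close>, so it is a set of equivalence classes
  rather than a type.\<close>

definition hyper :: "nat filter \<Rightarrow> (nat \<Rightarrow> 'a) set set" where
  "hyper U = UNIV // hyper_rel U"

definition hyper_class :: "nat filter \<Rightarrow> (nat \<Rightarrow> 'a) \<Rightarrow> (nat \<Rightarrow> 'a) set" where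
  "hyper_class U x = hyper_rel U `` {x}"

definition hyper_const :: "nat filter \<Rightarrow> 'a \<Rightarrow> (nat \<Rightarrow> 'a) set" where
  "hyper_const U r = hyper_class U (\<lambda>_. r)"

text \<open>Operations are lifted by applying them pointwise to all representatives; see
  \<open>hyper_lift1_class\<close>, \<open>hyper_lift2_class\<close> and \<open>hyper_less_class\<close> below.\<close>

definition hyper_lift1 ::
  "nat filter \<Rightarrow> ('a \<Rightarrow> 'a) \<Rightarrow> (nat \<Rightarrow> 'a) set \<Rightarrow> (nat \<Rightarrow> 'a) set" where
  "hyper_lift1 U f X = (\<Union>x\<in>X. hyper_class U (\<lambda>n. f (x n)))"

definition hyper_lift2 ::
  "nat filter \<Rightarrow> ('a \<Rightarrow> 'a \<Rightarrow> 'a) \<Rightarrow> (nat \<Rightarrow> 'a) set \<Rightarrow> (nat \<Rightarrow> 'a) set \<Rightarrow> (nat \<Rightarrow> 'a) set" where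
  "hyper_lift2 U f X Y = (\<Union>x\<in>X. \<Union>y\<in>Y. hyper_class U (\<lambda>n. f (x n) (y n)))"

definition hyper_less ::
  "nat filter \<Rightarrow> (nat \<Rightarrow> 'a::linordered_field) set \<Rightarrow> (nat \<Rightarrow> 'a) set \<Rightarrow> bool" where
  "hyper_less U X Y \<longleftrightarrow> (\<exists>x\<in>X. \<exists>y\<in>Y. eventually (\<lambda>n. x n < y n) U)"

definition hyper_le ::
  "nat filter \<Rightarrow> (nat \<Rightarrow> 'a::linordered_field) set \<Rightarrow> (nat \<Rightarrow> 'a) set \<Rightarrow> bool" where
  "hyper_le U X Y \<longleftrightarrow> hyper_less U X Y \<or> X = Y"

definition hyper_add ::
  "nat filter \<Rightarrow> (nat \<Rightarrow> 'a::linordered_field) set \<Rightarrow> (nat \<Rightarrow> 'a) set \<Rightarrow> (nat \<Rightarrow> 'a) set" where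
  "hyper_add U = hyper_lift2 U (+)"

definition hyper_divide ::
  "nat filter \<Rightarrow> (nat \<Rightarrow> 'a::linordered_field) set \<Rightarrow> (nat \<Rightarrow> 'a) set \<Rightarrow> (nat \<Rightarrow> 'a) set" where
  "hyper_divide U = hyper_lift2 U (/)"

definition hyper_uminus ::
  "nat filter \<Rightarrow> (nat \<Rightarrow> 'a::linordered_field) set \<Rightarrow> (nat \<Rightarrow> 'a) set" where
  "hyper_uminus U = hyper_lift1 U uminus"

definition hyper_abs ::
  "nat filter \<Rightarrow> (nat \<Rightarrow> 'a::linordered_field) set \<Rightarrow> (nat \<Rightarrow> 'a) set" where
  "hyper_abs U X = (if hyper_le U (hyper_uminus U X) X then X else hyper_uminus U X)"

definition hyper_of_nat :: "nat filter \<Rightarrow> nat \<Rightarrow> (nat \<Rightarrow> 'a::linordered_field) set" where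
  "hyper_of_nat U n = hyper_const U (of_nat n)"

definition hyper_finite :: "nat filter \<Rightarrow> (nat \<Rightarrow> 'a::linordered_field) set \<Rightarrow> bool" where
  "hyper_finite U X \<longleftrightarrow> X \<in> hyper U \<and> (\<exists>n. hyper_le U (hyper_abs U X) (hyper_of_nat U n))"

definition hyper_infinitesimal :: "nat filter \<Rightarrow> (nat \<Rightarrow> 'a::linordered_field) set \<Rightarrow> bool" where
  "hyper_infinitesimal U X \<longleftrightarrow> X \<in> hyper U \<and>
     (\<forall>n\<ge>1. hyper_less U (hyper_abs U X)
               (hyper_divide U (hyper_of_nat U 1) (hyper_of_nat U n)))"

definition leibniz_complete :: "nat filter \<Rightarrow> 'a::linordered_field itself \<Rightarrow> bool" where
  "leibniz_complete U K \<longleftrightarrow>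
     (\<forall>X::(nat \<Rightarrow> 'a) set. hyper_finite U X \<longrightarrow>
        (\<exists>!(p::'a \<times> (nat \<Rightarrow> 'a) set).
            hyper_infinitesimal U (snd p) \<and> X = hyper_add U (hyper_const U (fst p)) (snd p)))"

lemma equiv_hyper_rel: "equiv UNIV (hyper_rel U)"
proof (rule equivI)
  show "trans (hyper_rel U)"
    unfolding trans_def hyper_rel_def by (auto elim: eventually_elim2)
qed (auto simp: hyper_rel_def refl_on_def sym_def eq_commute)

lemma hyper_class_eq_iff:
  "hyper_class U x = hyper_class U y \<longleftrightarrow> eventually (\<lambda>n. x n = y n) U"
  using eq_equiv_class_iff[OF equiv_hyper_rel, of x y U]
  by (simp add: hyper_class_def hyper_rel_def)

lemma mem_hyper_class_iff: "y \<in> hyper_class U x \<longleftrightarrow> eventually (\<lambda>n. x n = y n) U"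
  by (simp add: hyper_class_def hyper_rel_def)

lemma hyper_eq_range: "hyper U = range (hyper_class U)"
  by (auto simp: hyper_def quotient_def hyper_class_def)

lemma hyper_lift1_class: "hyper_lift1 U f (hyper_class U x) = hyper_class U (\<lambda>n. f (x n))"
proof -
  have "hyper_class U (\<lambda>n. f (x' n)) = hyper_class U (\<lambda>n. f (x n))"
    if "x' \<in> hyper_class U x" for x'
    using that unfolding hyper_class_eq_iff mem_hyper_class_iff by (auto elim: eventually_mono)
  moreover have "x \<in> hyper_class U x"
    by (simp add: mem_hyper_class_iff)
  ultimately show ?thesis
    unfolding hyper_lift1_def by blast
qed

lemma hyper_lift2_class:
  "hyper_lift2 U f (hyper_class U x) (hyper_class U y) = hyper_class U (\<lambda>n. f (x n) (y n))"
proof -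
  have "hyper_class U (\<lambda>n. f (x' n) (y' n)) = hyper_class U (\<lambda>n. f (x n) (y n))"
    if "x' \<in> hyper_class U x" "y' \<in> hyper_class U y" for x' y'
    using that unfolding hyper_class_eq_iff mem_hyper_class_iff by (auto elim: eventually_elim2)
  moreover have "x \<in> hyper_class U x" "y \<in> hyper_class U y"
    by (simp_all add: mem_hyper_class_iff)
  ultimately show ?thesis
    unfolding hyper_lift2_def by blast
qed

lemma hyper_less_class:
  "hyper_less U (hyper_class U x) (hyper_class U y) \<longleftrightarrow> eventually (\<lambda>n. x n < y n) U"
proof
  assume "hyper_less U (hyper_class U x) (hyper_class U y)"
  then obtain x' y' where "eventually (\<lambda>n. x n = x' n) U" "eventually (\<lambda>n. y n = y' n) U"
    "eventually (\<lambda>n. x' n < y' n) U"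
    unfolding hyper_less_def by (auto simp: mem_hyper_class_iff)
  then show "eventually (\<lambda>n. x n < y n) U"
    by eventually_elim simp
next
  assume "eventually (\<lambda>n. x n < y n) U"
  moreover have "x \<in> hyper_class U x" "y \<in> hyper_class U y"
    by (simp_all add: mem_hyper_class_iff)
  ultimately show "hyper_less U (hyper_class U x) (hyper_class U y)"
    unfolding hyper_less_def by blast
qed

end

theory Submission
  imports Defs
begin

text \<open>
  A non-Archimedean field contains an upper bound \<open>w\<close> for the natural numbers, and the gap
  between the natural numbers and their upper bounds contradicts each kind of completeness.

  Distinct natural numbers are at distance at least \<open>1\<close>, so they form a bounded infinite set
  without cluster point, and a bounded increasing sequence without convergent subsequence
  (\<open>not_islimpt_of_nats\<close>, \<open>not_convergent_of_nat_subseq\<close>). If \<open>s\<close> is an upper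
  bound of the natural numbers, so is \<open>s - 1\<close>, hence there is no least one. For the Cantor
  property, the intervals from an element of the lower side of the gap to an element of its upper
  side have the finite intersection property, but a common point would have to lie in the gap; the
  field itself is large enough to index these intervals, which is where the assumption on the
  cardinal enters (\<open>cantor_complete_imp_archimedean\<close>).

  In the Leibniz case it is uniqueness that fails: \<open>1 / w\<close> is a non-zero standard element
  that is infinitesimal, so \<open>0 + 0\<close> and \<open>1 / w + (- 1 / w)\<close> are two decompositions
  of zero (\<open>leibniz_complete_imp_archimedean\<close>).
\<close>

section \<open>The natural numbers in a non-Archimedean field\<close>

lemma not_archimedeanE:
  assumes "\<not> archimedean TYPE('a::linordered_field)"
  obtains w :: "'a::linordered_field" where "\<And>n. of_nat n < w"
proof -
  from assms obtain x :: 'a where "\<forall>n. of_nat n < \<bar>x\<bar>"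
    unfolding archimedean_def by (auto simp: not_le)
  then show ?thesis using that by blast
qed

lemma order_bounded_of_nats:
  fixes w :: "'a::linordered_field"
  assumes "\<And>n. of_nat n < w"
  shows "order_bounded (range (of_nat :: nat \<Rightarrow> 'a))"
  unfolding order_bounded_def
proof
  show "bdd_below (range (of_nat :: nat \<Rightarrow> 'a))"
    by (rule bdd_belowI[of _ 0]) auto
  show "bdd_above (range (of_nat :: nat \<Rightarrow> 'a))"
    by (rule bdd_aboveI[of _ w]) (auto intro: less_imp_le assms)
qed

lemma of_nat_close_imp_eq:
  fixes x :: "'a::linordered_field"
  assumes "\<bar>of_nat m - x\<bar> < 1 / 2" "\<bar>of_nat n - x\<bar> < 1 / 2"
  shows "m = n"
proof -
  have "\<bar>of_nat m - of_nat n :: 'a\<bar> < 1"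
  proof -
    have "\<bar>of_nat m - of_nat n :: 'a\<bar> \<le> \<bar>of_nat m - x\<bar> + \<bar>of_nat n - x\<bar>"
      using abs_triangle_ineq4[of "of_nat m - x" "of_nat n - x"] by simp
    also have "\<dots> < 1 / 2 + 1 / 2"
      using assms by (rule add_strict_mono)
    finally show ?thesis by simp
  qed
  then have "(of_nat m :: 'a) < of_nat (Suc n)" "(of_nat n :: 'a) < of_nat (Suc m)"
    by (auto simp: abs_less_iff algebra_simps)
  then show ?thesis
    unfolding of_nat_less_iff by simp
qed

lemma open_abs_diff_less:
  fixes x :: "'a::{linordered_field, linorder_topology}"
  shows "open {y. \<bar>y - x\<bar> < e}"
proof -
  have "{y. \<bar>y - x\<bar> < e} = {x - e<..<x + e}"
    by (auto simp: abs_less_iff algebra_simps)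
  then show ?thesis by simp
qed

lemma not_islimpt_of_nats:
  fixes x :: "'a::{linordered_field, linorder_topology}"
  shows "\<not> x islimpt range (of_nat :: nat \<Rightarrow> 'a)"
proof
  assume x: "x islimpt range (of_nat :: nat \<Rightarrow> 'a)"
  obtain m where m: "of_nat m \<noteq> x" "\<bar>of_nat m - x\<bar> < 1 / 2"
    using islimptE[OF x _ open_abs_diff_less[of x "1/2"]] by auto
  \<comment> \<open>A second natural number, strictly closer to \<open>x\<close> than \<open>m\<close>.\<close>
  obtain n where n: "\<bar>of_nat n - x\<bar> < \<bar>of_nat m - x\<bar>"
    using islimptE[OF x _ open_abs_diff_less[of x "\<bar>of_nat m - x\<bar>"]] m(1) by auto
  have "m = n"
    using m(2) n by (intro of_nat_close_imp_eq[of m x n]) auto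
  with n show False by simp
qed

lemma not_convergent_of_nat_subseq:
  fixes r :: "nat \<Rightarrow> nat"
  assumes "strict_mono r"
  shows "\<not> convergent ((of_nat :: nat \<Rightarrow> 'a::{linordered_field, linorder_topology}) \<circ> r)"
proof
  assume "convergent ((of_nat :: nat \<Rightarrow> 'a) \<circ> r)"
  then obtain x :: 'a where "(of_nat \<circ> r) \<longlonglongrightarrow> x"
    by (auto simp: convergent_def)
  then have "eventually (\<lambda>n. (of_nat \<circ> r) n \<in> {y. \<bar>y - x\<bar> < 1 / 2}) sequentially"
    by (rule topological_tendstoD[OF _ open_abs_diff_less]) simp
  then obtain N where "\<And>n. n \<ge> N \<Longrightarrow> \<bar>of_nat (r n) - x\<bar> < 1 / 2"
    by (auto simp: eventually_sequentially)
  then have "r N = r (Suc N)"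
    by (intro of_nat_close_imp_eq) auto
  with assms show False
    by (metis n_not_Suc_n strict_mono_eq)
qed

section \<open>Cluster points, sequences and suprema\<close>

lemma bolzano_complete_imp_archimedean:
  assumes "bolzano_complete TYPE('a::{linordered_field, linorder_topology})"
  shows "archimedean TYPE('a)"
proof (rule ccontr)
  assume "\<not> archimedean TYPE('a)"
  then obtain w :: 'a where "\<And>n. of_nat n < w" by (rule not_archimedeanE) blast
  then have "order_bounded (range (of_nat :: nat \<Rightarrow> 'a))" by (rule order_bounded_of_nats)
  moreover have "infinite (range (of_nat :: nat \<Rightarrow> 'a))"
    by (simp add: range_inj_infinite inj_of_nat)
  ultimately show False
    using assms not_islimpt_of_nats unfolding bolzano_complete_def by blast
qed

lemma weierstrass_complete_imp_archimedean:
  assumes "weierstrass_complete TYPE('a::{linordered_field, linorder_topology})"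
  shows "archimedean TYPE('a)"
proof (rule ccontr)
  assume "\<not> archimedean TYPE('a)"
  then obtain w :: 'a where "\<And>n. of_nat n < w" by (rule not_archimedeanE) blast
  then have "order_bounded (range (of_nat :: nat \<Rightarrow> 'a))" by (rule order_bounded_of_nats)
  then show False
    using assms not_convergent_of_nat_subseq unfolding weierstrass_complete_def by blast
qed

lemma monotone_complete_imp_archimedean:
  assumes "monotone_complete TYPE('a::{linordered_field, linorder_topology})"
  shows "archimedean TYPE('a)"
proof (rule ccontr)
  assume "\<not> archimedean TYPE('a)"
  then obtain w :: 'a where "\<And>n. of_nat n < w" by (rule not_archimedeanE) blast
  then have "order_bounded (range (of_nat :: nat \<Rightarrow> 'a))" by (rule order_bounded_of_nats)
  moreover have "incseq (of_nat :: nat \<Rightarrow> 'a)" by (simp add: incseq_def)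
  ultimately have "convergent (of_nat :: nat \<Rightarrow> 'a)"
    using assms unfolding monotone_complete_def by blast
  then show False
    using not_convergent_of_nat_subseq[of id, where 'a = 'a] by (simp add: strict_mono_def)
qed

lemma dedekind_complete_imp_archimedean:
  assumes "dedekind_complete TYPE('a::linordered_field)"
  shows "archimedean TYPE('a)"
proof (rule ccontr)
  assume "\<not> archimedean TYPE('a)"
  then obtain w :: 'a where w: "\<And>n. of_nat n < w" by (rule not_archimedeanE) blast
  have "bdd_above (range (of_nat :: nat \<Rightarrow> 'a))"
    using order_bounded_of_nats[OF w] by (simp add: order_bounded_def)
  then obtain s :: 'a where s: "isLub UNIV (range of_nat) s"
    using assms unfolding dedekind_complete_def by blast
  have "of_nat n \<le> s - 1" for n
  proof -
    have "of_nat (Suc n) \<le> s"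
      using s by (rule isLubD2) (rule rangeI)
    then show ?thesis by (simp add: algebra_simps)
  qed
  then have "isUb UNIV (range of_nat) (s - 1)"
    by (auto simp: isUb_def setle_def)
  with s have "s \<le> s - 1" by (rule isLub_le_isUb)
  then show False by simp
qed

section \<open>Nested intervals around the gap\<close>

text \<open>
  The elements below some natural number form an initial segment without maximum, and the elements
  above all natural numbers a final segment without minimum. Every element \<open>x\<close> of the field
  indexes one interval, having \<open>x\<close> as its left end point if \<open>x\<close> is in the former
  set and as its right end point if it is in the latter. A point of all these intervals would be
  the maximum of the one or the minimum of the other.
\<close>
lemma cantor_complete_imp_archimedean:
  fixes \<kappa> :: "'k rel"
  assumes "Card_order \<kappa>" and card: "|UNIV :: 'a::linordered_field set| <o \<kappa>"
    and "cantor_complete \<kappa> TYPE('a)"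
  shows "archimedean TYPE('a)"
proof (rule ccontr)
  assume "\<not> archimedean TYPE('a)"
  then obtain w :: 'a where w: "\<And>n. of_nat n < w" by (rule not_archimedeanE) blast
  define L where "L = {x :: 'a. \<exists>n. x \<le> of_nat n}"
  have L_less: "x < y" if "x \<in> L" "y \<notin> L" for x y
    using that unfolding L_def mem_Collect_eq by (meson le_less_trans not_le)
  have "0 \<in> L" unfolding L_def by (auto intro: exI[of _ 0])
  have "w \<notin> L" using w by (auto simp: L_def not_le)
  have L_Suc: "x + 1 \<in> L" if "x \<in> L" for x
  proof -
    from that obtain n where "x \<le> of_nat n" by (auto simp: L_def)
    then have "x + 1 \<le> of_nat (Suc n)" by simp
    then show ?thesis unfolding L_def by blast
  qed

  have "|UNIV :: 'a set| \<le>o |Field \<kappa>|"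
    using card card_of_Field_ordIso[OF assms(1)]
    by (meson ordIso_symmetric ordLess_imp_ordLeq ordLeq_ordIso_trans)
  then obtain f :: "'a \<Rightarrow> 'k" where "inj f"
    by (auto simp: card_of_ordLeq[symmetric])
  define a where "a k = (if inv f k \<in> L then inv f k else 0)" for k
  define b where "b k = (if inv f k \<in> L then w else inv f k)" for k
  have a: "a k \<in> L" for k using \<open>0 \<in> L\<close> by (simp add: a_def)
  have b: "b k \<notin> L" for k using \<open>w \<notin> L\<close> by (simp add: b_def)

  have "(\<Inter>k\<in>\<Delta>. {a k..b k}) \<noteq> {}" if "finite \<Delta>" for \<Delta>
  proof -
    \<comment> \<open>The largest left end point lies below all right end points; the value \<open>0\<close> is
      inserted to make the maximum meaningful when \<open>\<Delta>\<close> is empty.\<close>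
    define z where "z = Max (insert 0 (a ` \<Delta>))"
    have "z \<in> insert 0 (a ` \<Delta>)" unfolding z_def using that by (intro Max_in) auto
    then have "z \<in> L" using a \<open>0 \<in> L\<close> by auto
    then have "z \<le> b k" for k using b L_less by (meson less_imp_le)
    moreover have "a k \<le> z" if "k \<in> \<Delta>" for k
      unfolding z_def using that \<open>finite \<Delta>\<close> by (intro Max_ge) auto
    ultimately have "z \<in> (\<Inter>k\<in>\<Delta>. {a k..b k})" by auto
    then show ?thesis by blast
  qed
  moreover have "|range f| <o \<kappa>"
    using card_of_image card by (rule ordLeq_ordLess_trans)
  ultimately have "(\<Inter>k\<in>range f. {a k..b k}) \<noteq> {}"
    using assms(3)[unfolded cantor_complete_def, rule_format, of "range f" a b] by simp
  then obtain z where *: "\<forall>x. a (f x) \<le> z \<and> z \<le> b (f x)" by auto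
  then have z: "x \<in> L \<Longrightarrow> x \<le> z" "x \<notin> L \<Longrightarrow> z \<le> x" for x
    using *[rule_format, of x] \<open>inj f\<close> by (auto simp: a_def b_def)
  show False
  proof (cases "z \<in> L")
    case True
    then show False using z(1)[OF L_Suc] by force
  next
    case False
    then have "z - 1 \<notin> L" using L_Suc[of "z - 1"] by auto
    then show False using z(2) by force
  qed
qed

section \<open>Two decompositions of zero in the non-standard extension\<close>

lemma hyper_less_const:
  assumes "U \<noteq> bot"
  shows "hyper_less U (hyper_const U r) (hyper_const U s) \<longleftrightarrow> r < s"
  using assms by (simp add: hyper_const_def hyper_less_class eventually_const_iff)

lemma hyper_const_eq_iff:
  assumes "U \<noteq> bot"
  shows "hyper_const U r = hyper_const U s \<longleftrightarrow> r = s"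
  using assms by (simp add: hyper_const_def hyper_class_eq_iff eventually_const_iff)

lemma hyper_abs_const:
  assumes "U \<noteq> bot"
  shows "hyper_abs U (hyper_const U r) = hyper_const U \<bar>r\<bar>"
proof -
  have uminus: "hyper_uminus U (hyper_const U r) = hyper_const U (- r)"
    by (simp add: hyper_uminus_def hyper_const_def hyper_lift1_class)
  have "hyper_le U (hyper_const U (- r)) (hyper_const U r) \<longleftrightarrow> - r \<le> r"
    by (simp only: hyper_le_def hyper_less_const[OF assms] hyper_const_eq_iff[OF assms] le_less)
  then show ?thesis
    by (simp add: hyper_abs_def uminus abs_if)
qed

lemma hyper_finite_const:
  fixes r :: "'a::linordered_field"
  assumes "U \<noteq> bot" "\<bar>r\<bar> \<le> of_nat n"
  shows "hyper_finite U (hyper_const U r)"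
proof -
  have "hyper_le U (hyper_abs U (hyper_const U r)) (hyper_of_nat U n)"
    using assms
    by (simp add: hyper_abs_const hyper_of_nat_def hyper_le_def hyper_less_const
        hyper_const_eq_iff le_less)
  then show ?thesis
    by (auto simp: hyper_finite_def hyper_const_def hyper_eq_range)
qed

lemma hyper_infinitesimal_const_iff:
  fixes r :: "'a::linordered_field"
  assumes "U \<noteq> bot"
  shows "hyper_infinitesimal U (hyper_const U r) \<longleftrightarrow> (\<forall>n\<ge>1. \<bar>r\<bar> < 1 / of_nat n)"
proof -
  have "hyper_divide U (hyper_of_nat U 1) (hyper_of_nat U n) = hyper_const U (1 / of_nat n :: 'a)"
    for n
    by (simp add: hyper_divide_def hyper_of_nat_def hyper_const_def hyper_lift2_class)
  moreover have "hyper_const U r \<in> hyper U"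
    by (simp add: hyper_const_def hyper_eq_range)
  ultimately show ?thesis
    using assms by (simp add: hyper_infinitesimal_def hyper_abs_const hyper_less_const)
qed

lemma leibniz_complete_imp_archimedean:
  assumes "U \<noteq> bot" and "leibniz_complete U TYPE('a::linordered_field)"
  shows "archimedean TYPE('a)"
proof (rule ccontr)
  assume "\<not> archimedean TYPE('a)"
  then obtain w :: 'a where w: "\<And>n. of_nat n < w" by (rule not_archimedeanE) blast
  have "0 < w" using w[of 0] by simp
  have small: "\<bar>- (1 / w)\<bar> < 1 / of_nat n" if "n \<ge> 1" for n
  proof -
    have "1 / w < 1 / of_nat n"
      using that w[of n] by (intro divide_strict_left_mono) (auto simp: \<open>0 < w\<close>)
    then show ?thesis using \<open>0 < w\<close> by simp
  qed
  define decomp where "decomp p \<longleftrightarrow>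
    hyper_infinitesimal U (snd p) \<and> hyper_const U 0 = hyper_add U (hyper_const U (fst p)) (snd p)"
    for p :: "'a \<times> (nat \<Rightarrow> 'a) set"
  have add: "hyper_add U (hyper_const U r) (hyper_const U s) = hyper_const U (r + s)" for r s :: 'a
    by (simp add: hyper_add_def hyper_const_def hyper_lift2_class)
  have "hyper_finite U (hyper_const U (0 :: 'a))"
    using assms(1) by (rule hyper_finite_const[of _ _ 0]) simp
  then have "\<exists>!p. decomp p"
    using assms(2) unfolding leibniz_complete_def decomp_def by blast
  moreover have "decomp (0, hyper_const U 0)"
    using assms(1) by (simp add: decomp_def hyper_infinitesimal_const_iff add)
  moreover have "decomp (1 / w, hyper_const U (- (1 / w)))"
    unfolding decomp_def fst_conv snd_conv add hyper_infinitesimal_const_iff[OF assms(1)]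
    using small by simp
  ultimately have "0 = 1 / w" by blast
  with \<open>0 < w\<close> show False by simp
qed

section \<open>Complete ordered fields are Archimedean\<close>

theorem theorem5p1:
  fixes U :: "nat filter"
  assumes "free_ultrafilter U"
  shows
    "(bolzano_complete TYPE('a::{linordered_field, linorder_topology})
      \<or> weierstrass_complete TYPE('a)
      \<or> monotone_complete TYPE('a)
      \<or> dedekind_complete TYPE('a)
      \<or> (\<exists>\<kappa>::'k rel. uncountable_cardinal \<kappa> \<and> |UNIV::'a set| <o \<kappa> \<and> cantor_complete \<kappa> TYPE('a))
      \<or> leibniz_complete U TYPE('a)
      \<longrightarrow> archimedean TYPE('a))
   \<and> (\<not> archimedean TYPE('a) \<longrightarrow>
        \<not> bolzano_complete TYPE('a)
      \<and> \<not> weierstrass_complete TYPE('a)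
      \<and> \<not> monotone_complete TYPE('a)
      \<and> \<not> dedekind_complete TYPE('a)
      \<and> \<not> (\<exists>\<kappa>::'k rel. uncountable_cardinal \<kappa> \<and> |UNIV::'a set| <o \<kappa> \<and> cantor_complete \<kappa> TYPE('a))
      \<and> \<not> leibniz_complete U TYPE('a))"
proof -
  have "U \<noteq> bot" using assms by (simp add: free_ultrafilter_def)
  then show ?thesis
    using bolzano_complete_imp_archimedean[where 'a = 'a]
      weierstrass_complete_imp_archimedean[where 'a = 'a]
      monotone_complete_imp_archimedean[where 'a = 'a]
      dedekind_complete_imp_archimedean[where 'a = 'a]
      cantor_complete_imp_archimedean[where 'a = 'a and 'k = 'k]
      leibniz_complete_imp_archimedean[where 'a = 'a and U = U]
    unfolding uncountable_cardinal_def by blast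
qed

end
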